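(* Let $\mu$ be a positive finite Borel measure on $[0,1)$ and let $R_\mu$ be the Rhaly operator associated to the moment sequence $(\mu_n)_{n\ge 0}$, $\mu_n=\int_0^1 t^n\,d\mu(t)$, acting boundedly on $\ell^2$. Then the operator $-R_\mu$ is the infinitesimal generator of a contraction semigroup.
   Context: $\ell^2=\ell^2(\mathbb{N}_0)$ is the complex Hilbert space of square-summable sequences $(x_n)_{n\ge 0}$. The Rhaly operator $R_\mu$ is given by the lower triangular matrix whose $(n,k)$ entry is $\mu_n$ for $0\le k\le n$ and $0$ for $k>n$, i.e. $(R_\mu x)_n=\mu_n\sum_{k=0}^n x_k$. A contraction semigroup is a strongly continuous one-parameter semigroup $(T(s))_{s\ge 0}$ of bounded operators on $\ell^2$ with $\|T(s)\|\le 1$ for all $s\ge 0$. The convention $0^0=1$ is used in $\mu_0=\mu([0,1))$. *)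

theory Defs
  imports "HOL-Analysis.Analysis"
begin

typedef ell2 = "{x :: nat \<Rightarrow> complex. summable (\<lambda>n. (cmod (x n))\<^sup>2)}"
  morphisms coord Abs_ell2
  by (rule exI[of _ "\<lambda>_. 0"]) simp

setup_lifting type_definition_ell2

lemma ell2_summable_add:
  fixes x y :: "nat \<Rightarrow> complex"
  assumes "summable (\<lambda>n. (cmod (x n))\<^sup>2)" "summable (\<lambda>n. (cmod (y n))\<^sup>2)"
  shows "summable (\<lambda>n. (cmod (x n + y n))\<^sup>2)"
proof (rule summable_comparison_test')
  show "summable (\<lambda>n. 2 * (cmod (x n))\<^sup>2 + 2 * (cmod (y n))\<^sup>2)"
    by (intro summable_add summable_mult assms)
  fix n
  have "(cmod (x n + y n))\<^sup>2 \<le> (cmod (x n) + cmod (y n))\<^sup>2"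
    by (intro power_mono norm_triangle_ineq norm_ge_zero)
  also have "\<dots> \<le> 2 * (cmod (x n))\<^sup>2 + 2 * (cmod (y n))\<^sup>2"
    using zero_le_power2[of "cmod (x n) - cmod (y n)"]
    by (simp add: power2_sum power2_diff)
  finally show "norm ((cmod (x n + y n))\<^sup>2) \<le> 2 * (cmod (x n))\<^sup>2 + 2 * (cmod (y n))\<^sup>2"
    by simp
qed

lemma ell2_summable_inner:
  fixes x y :: "nat \<Rightarrow> complex"
  assumes "summable (\<lambda>n. (cmod (x n))\<^sup>2)" "summable (\<lambda>n. (cmod (y n))\<^sup>2)"
  shows "summable (\<lambda>n. x n \<bullet> y n)"
proof (rule summable_comparison_test')
  show "summable (\<lambda>n. (cmod (x n))\<^sup>2 + (cmod (y n))\<^sup>2)"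
    by (intro summable_add assms)
  fix n
  have "\<bar>x n \<bullet> y n\<bar> \<le> cmod (x n) * cmod (y n)"
    by (rule Cauchy_Schwarz_ineq2)
  also have "\<dots> \<le> (cmod (x n))\<^sup>2 + (cmod (y n))\<^sup>2"
  proof -
    have "0 \<le> cmod (x n) * cmod (y n)" by simp
    moreover have "2 * (cmod (x n) * cmod (y n)) \<le> (cmod (x n))\<^sup>2 + (cmod (y n))\<^sup>2"
      using sum_squares_bound[of "cmod (x n)" "cmod (y n)"] by (simp add: mult.assoc)
    ultimately show ?thesis by linarith
  qed
  finally show "norm (x n \<bullet> y n) \<le> (cmod (x n))\<^sup>2 + (cmod (y n))\<^sup>2"
    by simp
qed

lift_definition scale_ell2 :: "complex \<Rightarrow> ell2 \<Rightarrow> ell2" (infixr "*\<^sub>C" 75)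
  is "\<lambda>c x n. c * x n"
  by (simp add: norm_mult power_mult_distrib summable_mult)

text \<open>
  The library has no class of complex inner product spaces. The instance below is the
  underlying real one: \<^term>\<open>x \<bullet> y\<close> is the real part of the Hermitian inner product
  of \<open>\<ell>\<^sup>2\<close>, which induces the same norm. Complex scalars act through \<open>*\<^sub>C\<close>.
\<close>

instantiation ell2 :: real_inner
begin

lift_definition zero_ell2 :: ell2 is "\<lambda>_. 0" by simp

lift_definition plus_ell2 :: "ell2 \<Rightarrow> ell2 \<Rightarrow> ell2" is "\<lambda>x y n. x n + y n"
  by (rule ell2_summable_add)

lift_definition uminus_ell2 :: "ell2 \<Rightarrow> ell2" is "\<lambda>x n. - x n" by simp

lift_definition minus_ell2 :: "ell2 \<Rightarrow> ell2 \<Rightarrow> ell2" is "\<lambda>x y n. x n - y n"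
  using ell2_summable_add[where y = "\<lambda>n. - f n" for f] by simp

lift_definition scaleR_ell2 :: "real \<Rightarrow> ell2 \<Rightarrow> ell2" is "\<lambda>r x n. r *\<^sub>R x n"
  by (simp add: power_mult_distrib summable_mult)

lift_definition inner_ell2 :: "ell2 \<Rightarrow> ell2 \<Rightarrow> real" is "\<lambda>x y. \<Sum>n. x n \<bullet> y n" .

lift_definition norm_ell2 :: "ell2 \<Rightarrow> real" is "\<lambda>x. sqrt (\<Sum>n. (cmod (x n))\<^sup>2)" .

definition dist_ell2 :: "ell2 \<Rightarrow> ell2 \<Rightarrow> real"
  where "dist_ell2 x y = norm (x - y)"

definition sgn_ell2 :: "ell2 \<Rightarrow> ell2"
  where "sgn_ell2 x = inverse (norm x) *\<^sub>R x"

definition uniformity_ell2 :: "(ell2 \<times> ell2) filter"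
  where "uniformity_ell2 = (INF e\<in>{0<..}. principal {(x, y). dist x y < e})"

definition open_ell2 :: "ell2 set \<Rightarrow> bool"
  where "open_ell2 U \<longleftrightarrow> (\<forall>x\<in>U. \<forall>\<^sub>F (x', y) in uniformity. x' = x \<longrightarrow> y \<in> U)"

instance
proof
  fix x y z :: ell2 and r s :: real
  show "x + y + z = x + (y + z)" by transfer (simp add: add.assoc)
  show "x + y = y + x" by transfer (simp add: add.commute)
  show "0 + x = x" by transfer simp
  show "- x + x = 0" by transfer simp
  show "x - y = x + - y" by transfer simp
  show "r *\<^sub>R (x + y) = r *\<^sub>R x + r *\<^sub>R y" by transfer (simp add: scaleR_add_right)
  show "(r + s) *\<^sub>R x = r *\<^sub>R x + s *\<^sub>R x" by transfer (simp add: scaleR_add_left)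
  show "r *\<^sub>R s *\<^sub>R x = (r * s) *\<^sub>R x" by transfer simp
  show "1 *\<^sub>R x = x" by transfer simp
  show "dist x y = norm (x - y)" by (rule dist_ell2_def)
  show "sgn x = inverse (norm x) *\<^sub>R x" by (rule sgn_ell2_def)
  show "uniformity = (INF e\<in>{0<..}. principal {(x :: ell2, y). dist x y < e})"
    by (rule uniformity_ell2_def)
  show "open U \<longleftrightarrow> (\<forall>x\<in>U. \<forall>\<^sub>F (x', y) in uniformity. x' = x \<longrightarrow> y \<in> U)" for U :: "ell2 set"
    by (rule open_ell2_def)
  show "x \<bullet> y = y \<bullet> x" by transfer (simp add: inner_commute)
  show "(x + y) \<bullet> z = x \<bullet> z + y \<bullet> z"
    by transfer (simp add: inner_add_left suminf_add ell2_summable_inner)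
  show "(r *\<^sub>R x) \<bullet> y = r * (x \<bullet> y)"
    by transfer (simp add: suminf_mult ell2_summable_inner)
  show "0 \<le> x \<bullet> x"
    by transfer (simp add: suminf_nonneg ell2_summable_inner)
  show "x \<bullet> x = 0 \<longleftrightarrow> x = 0"
    by transfer (auto simp: suminf_eq_zero_iff ell2_summable_inner)
  show "norm x = sqrt (x \<bullet> x)"
    by transfer (simp add: power2_norm_eq_inner)
qed

end

definition bounded_clinear :: "(ell2 \<Rightarrow> ell2) \<Rightarrow> bool"
  where "bounded_clinear T \<longleftrightarrow> bounded_linear T \<and> (\<forall>c x. T (c *\<^sub>C x) = c *\<^sub>C T x)"

definition moment :: "real measure \<Rightarrow> nat \<Rightarrow> real"
  where "moment M n = (LINT t|M. t ^ n)"

definition rhaly_operator :: "(nat \<Rightarrow> real) \<Rightarrow> (ell2 \<Rightarrow> ell2) \<Rightarrow> bool"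
  where "rhaly_operator a R \<longleftrightarrow>
    (\<forall>x n. coord (R x) n = complex_of_real (a n) * (\<Sum>k\<le>n. coord x k))"

definition contraction_semigroup :: "(real \<Rightarrow> ell2 \<Rightarrow> ell2) \<Rightarrow> bool"
  where "contraction_semigroup T \<longleftrightarrow>
    (\<forall>s\<ge>0. bounded_clinear (T s)) \<and>
    T 0 = id \<and>
    (\<forall>s\<ge>0. \<forall>t\<ge>0. T (s + t) = T s \<circ> T t) \<and>
    (\<forall>x. continuous_on {0..} (\<lambda>s. T s x)) \<and>
    (\<forall>s\<ge>0. onorm (T s) \<le> 1)"

text \<open>
  Generators are in general only partially defined, so the generator is given as its graph;
  its domain consists of all \<open>x\<close> for which the limit exists.
\<close>

definition generator_graph :: "(real \<Rightarrow> ell2 \<Rightarrow> ell2) \<Rightarrow> (ell2 \<times> ell2) set"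
  where "generator_graph T =
    {(x, y). ((\<lambda>h. (T h x - x) /\<^sub>R h) \<longlongrightarrow> y) (at_right 0)}"

definition generates :: "(ell2 \<Rightarrow> ell2) \<Rightarrow> (real \<Rightarrow> ell2 \<Rightarrow> ell2) \<Rightarrow> bool"
  where "generates A T \<longleftrightarrow> generator_graph T = {(x, y). y = A x}"

end

(*
  The moments are nonnegative and decreasing, so summation by parts shows that the real part of
  the Hermitian product of R x with x is nonnegative. Hence the norm of every solution of
  u' = - R u is nonincreasing, which makes the exponential series of the bounded operator - t R
  a contraction for t >= 0 and yields the semigroup law by uniqueness of solutions.
*)

theory Submission imports Defs begin

section \<open>Coordinates, norm and completeness of the sequence space\<close>

lemma coord_simps [simp]:
  "coord 0 n = 0" "coord (x + y) n = coord x n + coord y n"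
  "coord (x - y) n = coord x n - coord y n" "coord (- x) n = - coord x n"
  "coord (r *\<^sub>R x) n = r *\<^sub>R coord x n" "coord (c *\<^sub>C x) n = c * coord x n"
  by (transfer, simp)+

lemma summable_coord: "summable (\<lambda>n. (cmod (coord x n))\<^sup>2)"
  by transfer simp

lemma norm_ell2_square: "(norm x)\<^sup>2 = (\<Sum>n. (cmod (coord x n))\<^sup>2)"
  by transfer (simp add: suminf_nonneg)

lemma inner_ell2_sums: "(\<lambda>n. coord x n \<bullet> coord y n) sums (x \<bullet> y)"
  by transfer (simp add: ell2_summable_inner summable_sums)

text \<open>Finite truncations carry norm bounds over to coordinatewise limits, because a limit
  commutes with a finite sum.\<close>

lemma sum_coord_le_norm: "(\<Sum>k<n. (cmod (coord x k))\<^sup>2) \<le> (norm x)\<^sup>2"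
  unfolding norm_ell2_square by (intro sum_le_suminf summable_coord) auto

lemma cmod_coord_le_norm: "cmod (coord x n) \<le> norm x"
proof -
  have "(cmod (coord x n))\<^sup>2 \<le> (\<Sum>k<Suc n. (cmod (coord x k))\<^sup>2)"
    by (simp add: sum_nonneg)
  also have "\<dots> \<le> (norm x)\<^sup>2" by (rule sum_coord_le_norm)
  finally show ?thesis by (rule power2_le_imp_le) simp
qed

lemma norm_scale_ell2: "norm (c *\<^sub>C x) = cmod c * norm x"
proof (rule power2_eq_imp_eq)
  show "(norm (c *\<^sub>C x))\<^sup>2 = (cmod c * norm x)\<^sup>2"
    by (simp add: norm_ell2_square power_mult_distrib norm_mult suminf_mult summable_coord)
qed auto

lemma bounded_linear_scale_ell2: "bounded_linear ((*\<^sub>C) c)"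
proof (rule bounded_linear_intro)
  show "c *\<^sub>C (x + y) = c *\<^sub>C x + c *\<^sub>C y" for x y by transfer (simp add: algebra_simps)
  show "c *\<^sub>C r *\<^sub>R x = r *\<^sub>R c *\<^sub>C x" for r x by transfer (simp add: algebra_simps)
  show "norm (c *\<^sub>C x) \<le> norm x * cmod c" for x by (simp add: norm_scale_ell2)
qed

text \<open>Each coordinate is dominated by the norm, so a Cauchy sequence has a coordinatewise
  limit; bounds on finite truncations put this limit in the space and make the convergence hold in
  norm. Completeness is what lets the exponential series converge.\<close>

instance ell2 :: banach
proof
  fix X :: "nat \<Rightarrow> ell2"
  assume X: "Cauchy X"
  have "Cauchy (\<lambda>m. coord (X m) n)" for n
  proof (rule metric_CauchyI)
    fix e :: real assume "0 < e"
    then obtain K where K: "\<And>l m. K \<le> l \<Longrightarrow> K \<le> m \<Longrightarrow> norm (X l - X m) < e"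
      using CauchyD[OF X] by blast
    have "dist (coord (X l) n) (coord (X m) n) < e" if "K \<le> l" "K \<le> m" for l m
      using cmod_coord_le_norm[of "X l - X m" n] K[OF that] by (simp add: dist_norm)
    then show "\<exists>K. \<forall>l\<ge>K. \<forall>m\<ge>K. dist (coord (X l) n) (coord (X m) n) < e" by blast
  qed
  then have "convergent (\<lambda>m. coord (X m) n)" for n
    by (rule Cauchy_convergent)
  then obtain y where y: "(\<lambda>m. coord (X m) n) \<longlonglongrightarrow> y n" for n
    using that[of "\<lambda>n. lim (\<lambda>m. coord (X m) n)"] unfolding convergent_LIMSEQ_iff by blast
  obtain B where B: "\<And>m. norm (X m) \<le> B"
    using BseqD[OF Cauchy_Bseq[OF X]] by blast
  have "(\<Sum>k<n. (cmod (y k))\<^sup>2) \<le> B\<^sup>2" for n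
  proof (rule LIMSEQ_le_const2)
    show "(\<lambda>m. \<Sum>k<n. (cmod (coord (X m) k))\<^sup>2) \<longlonglongrightarrow> (\<Sum>k<n. (cmod (y k))\<^sup>2)"
      by (intro tendsto_sum tendsto_power tendsto_norm y)
    have "(\<Sum>k<n. (cmod (coord (X m) k))\<^sup>2) \<le> B\<^sup>2" for m
      by (rule order_trans[OF sum_coord_le_norm]) (simp add: B power_mono)
    then show "\<exists>N. \<forall>m\<ge>N. (\<Sum>k<n. (cmod (coord (X m) k))\<^sup>2) \<le> B\<^sup>2" by blast
  qed
  then have "summable (\<lambda>n. (cmod (y n))\<^sup>2)"
    by (intro bounded_imp_summable[of _ "B\<^sup>2"]) (simp_all only: zero_le_power2 flip: lessThan_Suc_atMost)
  then have z: "coord (Abs_ell2 y) = y" by (simp add: Abs_ell2_inverse)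
  have "X \<longlonglongrightarrow> Abs_ell2 y"
  proof (rule LIMSEQ_I)
    fix e :: real assume e: "0 < e"
    \<comment> \<open>Passing to the limit in \<open>m\<close> keeps only a non-strict inequality,
      so \<open>e / 2\<close> is used to end strictly below \<open>e\<close>.\<close>
    then obtain K where K: "\<And>l m. K \<le> l \<Longrightarrow> K \<le> m \<Longrightarrow> norm (X l - X m) < e / 2"
      using CauchyD[OF X, of "e / 2"] half_gt_zero[OF e] by blast
    have "norm (X l - Abs_ell2 y) < e" if l: "K \<le> l" for l
    proof -
      \<comment> \<open>Here \<open>l\<close> and \<open>n\<close> stay fixed while \<open>m\<close>
        tends to infinity in the Cauchy estimate.\<close>
      have "(\<Sum>k<n. (cmod (coord (X l - Abs_ell2 y) k))\<^sup>2) \<le> (e / 2)\<^sup>2" for n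
      proof (rule LIMSEQ_le_const2)
        show "(\<lambda>m. \<Sum>k<n. (cmod (coord (X l - X m) k))\<^sup>2)
            \<longlonglongrightarrow> (\<Sum>k<n. (cmod (coord (X l - Abs_ell2 y) k))\<^sup>2)"
          unfolding coord_simps z by (intro tendsto_sum tendsto_power tendsto_norm tendsto_diff tendsto_const y)
        have "(\<Sum>k<n. (cmod (coord (X l - X m) k))\<^sup>2) \<le> (e / 2)\<^sup>2" if "K \<le> m" for m
          using K[OF l that] by (intro order_trans[OF sum_coord_le_norm] power_mono) auto
        then show "\<exists>N. \<forall>m\<ge>N. (\<Sum>k<n. (cmod (coord (X l - X m) k))\<^sup>2) \<le> (e / 2)\<^sup>2"
          by blast
      qed
      then have "(norm (X l - Abs_ell2 y))\<^sup>2 \<le> (e / 2)\<^sup>2"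
        unfolding norm_ell2_square by (intro suminf_le_const summable_coord)
      then have "norm (X l - Abs_ell2 y) \<le> e / 2" by (rule power2_le_imp_le) (use e in simp)
      then show ?thesis using e by simp
    qed
    then show "\<exists>K. \<forall>l\<ge>K. norm (X l - Abs_ell2 y) < e" by blast
  qed
  then show "convergent X" by (auto simp: convergent_def)
qed

section \<open>Summation by parts and accretivity of the Rhaly operator\<close>

lemma Abel_sum_nonneg:
  fixes a s :: "nat \<Rightarrow> real"
  assumes "decseq a" "\<And>n. 0 \<le> a n" "\<And>n. 0 \<le> s n"
  shows "0 \<le> a 0 * s 0 + (\<Sum>k<n. a (Suc k) * (s (Suc k) - s k))"
proof -
  \<comment> \<open>The lower bound \<open>a n * s n\<close> rather than \<open>0\<close> makes the
    induction work: replacing \<open>a n\<close> by the smaller \<open>a (Suc n)\<close> in it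
    leaves exactly the amount that the new summand subtracts.\<close>
  have "a n * s n \<le> a 0 * s 0 + (\<Sum>k<n. a (Suc k) * (s (Suc k) - s k))"
  proof (induction n)
    case (Suc n)
    have "a (Suc n) * s n \<le> a n * s n"
      using assms by (intro mult_right_mono) (auto simp: decseq_Suc_iff)
    then show ?case using Suc by (simp add: algebra_simps)
  qed simp
  moreover have "0 \<le> a n * s n" using assms by simp
  ultimately show ?thesis by linarith
qed

text \<open>
  With \<open>S n = x 0 + \<dots> + x n\<close>, the real part of \<open>S n\<close> times the conjugate of
  \<open>x n = S n - S (n - 1)\<close> is at least half the increment of \<open>\<bar>S n\<bar>\<^sup>2\<close>.
\<close>

lemma rhaly_operator_accretive:
  assumes R: "rhaly_operator a R" and a: "decseq a" "\<And>n. 0 \<le> a n"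
  shows "0 \<le> x \<bullet> R x"
proof -
  define S where "S n = (\<Sum>k\<le>n. coord x k)" for n
  have Rx: "coord (R x) n = a n *\<^sub>R S n" for n
    using R by (simp add: rhaly_operator_def S_def scaleR_conv_of_real)
  have step: "(cmod (S (Suc n)))\<^sup>2 - (cmod (S n))\<^sup>2 \<le> 2 * (coord x (Suc n) \<bullet> S (Suc n))" for n
  proof -
    have "S (Suc n) = S n + coord x (Suc n)" by (simp add: S_def)
    then have "2 * (coord x (Suc n) \<bullet> S (Suc n)) - ((cmod (S (Suc n)))\<^sup>2 - (cmod (S n))\<^sup>2)
        = (cmod (coord x (Suc n)))\<^sup>2"
      by (simp add: power2_norm_eq_inner inner_add_left inner_add_right inner_commute)
    then show ?thesis by (metis diff_ge_0_iff_ge zero_le_power2)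
  qed
  have "0 \<le> (\<Sum>k<n. coord x k \<bullet> coord (R x) k)" for n
  proof (cases n)
    case (Suc m)
    have "0 \<le> a 0 * (cmod (S 0))\<^sup>2
        + (\<Sum>k<m. a (Suc k) * ((cmod (S (Suc k)))\<^sup>2 - (cmod (S k))\<^sup>2))"
      by (intro Abel_sum_nonneg a) auto
    also have "\<dots> \<le> 2 * (a 0 * (coord x 0 \<bullet> S 0))
        + (\<Sum>k<m. 2 * (a (Suc k) * (coord x (Suc k) \<bullet> S (Suc k))))"
    proof (intro add_mono sum_mono)
      \<comment> \<open>Index \<open>0\<close> has no predecessor and is treated apart:
        \<open>S 0 = coord x 0\<close>, so the right side is twice the left.\<close>
      show "a 0 * (cmod (S 0))\<^sup>2 \<le> 2 * (a 0 * (coord x 0 \<bullet> S 0))"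
        using a by (simp add: S_def power2_norm_eq_inner)
      show "a (Suc k) * ((cmod (S (Suc k)))\<^sup>2 - (cmod (S k))\<^sup>2)
          \<le> 2 * (a (Suc k) * (coord x (Suc k) \<bullet> S (Suc k)))" for k
        using mult_left_mono[OF step a(2), of "Suc k" k] by (simp add: mult.left_commute)
    qed
    also have "\<dots> = 2 * (\<Sum>k<n. coord x k \<bullet> coord (R x) k)"
      by (simp add: Suc Rx sum.lessThan_Suc_shift sum_distrib_left del: sum.lessThan_Suc)
    finally show ?thesis by simp
  qed simp
  then show ?thesis
    using LIMSEQ_le_const[OF inner_ell2_sums[unfolded sums_def]] by blast
qed

text \<open>On \<open>{0..<1}\<close> the powers \<open>t ^ n\<close> lie between \<open>0\<close>
  and \<open>1\<close> and decrease in \<open>n\<close>; finiteness of \<open>M\<close> makes them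
  integrable, so the integrals inherit both properties.\<close>

lemma
  assumes "finite_measure M" and "sets M = sets (restrict_space borel {0..<1})"
  shows moment_nonneg: "0 \<le> moment M n" and decseq_moment: "decseq (moment M)"
proof -
  interpret finite_measure M by fact
  have sp: "space M = {0..<1}"
    using sets_eq_imp_space_eq[OF assms(2)] by (simp add: space_restrict_space)
  have "(\<lambda>t. t ^ n) \<in> borel_measurable (restrict_space borel {0..<1::real})" for n
    by (intro measurable_restrict_space1) measurable
  then have meas: "(\<lambda>t. t ^ n) \<in> borel_measurable M" for n
    using measurable_cong_sets[OF assms(2) refl] by blast
  have int: "integrable M (\<lambda>t. t ^ n)" for n
    by (rule integrable_const_bound[of _ 1])
      (auto simp: sp abs_if power_le_one intro!: AE_I2 meas)
  show "0 \<le> moment M n"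
    unfolding moment_def by (rule integral_nonneg_AE) (auto simp: sp intro!: AE_I2)
  show "decseq (moment M)"
    unfolding decseq_Suc_iff moment_def
    by (intro allI integral_mono int) (auto simp: sp mult_left_le_one_le)
qed

section \<open>The exponential of a bounded operator\<close>

definition op_exp :: "('a::real_normed_vector \<Rightarrow> 'a) \<Rightarrow> real \<Rightarrow> 'a \<Rightarrow> 'a"
  where "op_exp A t x = (\<Sum>n. (t ^ n / fact n) *\<^sub>R (A ^^ n) x)"

text \<open>Differentiating \<open>t ^ Suc n / fact (Suc n)\<close> gives
  \<open>t ^ n / fact n\<close>, so termwise differentiation shifts the coefficients. The growth
  bound supplies a scalar exponential series as majorant, uniformly on bounded intervals. The case
  of interest is \<open>a n = (A ^^ n) x\<close>.\<close>

lemma exp_series_has_vector_derivative: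
  fixes a :: "nat \<Rightarrow> 'a::banach"
  assumes a: "\<And>n. norm (a n) \<le> K * C ^ n" and "0 \<le> C"
  shows "summable (\<lambda>n. (t ^ n / fact n) *\<^sub>R a n)"
    and "((\<lambda>t. \<Sum>n. (t ^ n / fact n) *\<^sub>R a n) has_vector_derivative
      (\<Sum>n. (t ^ n / fact n) *\<^sub>R a (Suc n))) (at t)"
proof -
  have majorant: "summable (\<lambda>n. D * ((r * C) ^ n / fact n))" for D r
    using summable_exp_generic[of "r * C"]
    by (intro summable_mult) (simp add: divide_inverse mult.commute)
  have bound: "norm ((t ^ n / fact n) *\<^sub>R b) \<le> D * ((r * C) ^ n / fact n)"
    if "\<bar>t\<bar> \<le> r" "norm b \<le> D * C ^ n" for t r D n and b :: 'a
  proof -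
    have "norm ((t ^ n / fact n) *\<^sub>R b) = \<bar>t\<bar> ^ n / fact n * norm b"
      by (simp add: power_abs)
    also have "\<dots> \<le> r ^ n / fact n * (D * C ^ n)"
      using that by (intro mult_mono divide_right_mono power_mono) auto
    finally show ?thesis by (simp add: power_mult_distrib mult_ac)
  qed
  show summ: "summable (\<lambda>n. (t ^ n / fact n) *\<^sub>R a n)" for t
    by (rule summable_comparison_test'[OF majorant bound[OF order_refl a]])
  \<comment> \<open>The margin \<open>1\<close> makes \<open>t\<close> an interior point of
    \<open>{-r..r}\<close>, so that a derivative within the interval is a full derivative at
    \<open>t\<close>.\<close>
  define r where "r = \<bar>t\<bar> + 1"
  define g where "g t = (\<Sum>n. (t ^ n / fact n) *\<^sub>R a (Suc n))" for t
  have lim: "uniform_limit {-r..r} (\<lambda>n t. \<Sum>i<n. (t ^ i / fact i) *\<^sub>R a (Suc i)) g sequentially"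
    unfolding g_def
  proof (rule Weierstrass_m_test[OF _ majorant])
    show "norm ((t ^ n / fact n) *\<^sub>R a (Suc n)) \<le> K * C * ((r * C) ^ n / fact n)"
      if "t \<in> {-r..r}" for n t
      using that a[of "Suc n"] by (intro bound) (auto simp: mult.assoc)
  qed
  \<comment> \<open>The constant term drops out, so \<open>Suc n\<close> summands differentiate to
    \<open>n\<close> shifted ones.\<close>
  have partial: "((\<lambda>t. \<Sum>i<Suc n. (t ^ i / fact i) *\<^sub>R a i) has_derivative
      (\<lambda>h. h *\<^sub>R (\<Sum>i<n. (t ^ i / fact i) *\<^sub>R a (Suc i)))) (at t within S)" for n t S
  proof (induction n)
    case (Suc n)
    have "((\<lambda>t. t ^ Suc n / fact (Suc n)) has_real_derivative t ^ n / fact n) (at t within S)"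
      by (rule DERIV_cong[OF DERIV_cdivide[OF DERIV_pow]]) (simp del: of_nat_Suc)
    from has_derivative_scaleR_left[OF this[unfolded has_field_derivative_def], of "a (Suc n)"]
    have "((\<lambda>t. (t ^ Suc n / fact (Suc n)) *\<^sub>R a (Suc n)) has_derivative
        (\<lambda>h. h *\<^sub>R ((t ^ n / fact n) *\<^sub>R a (Suc n)))) (at t within S)"
      by (simp add: mult.commute)
    from has_derivative_add[OF Suc this] show ?case
      by (simp add: scaleR_add_right)
  qed simp
  have "\<exists>f. \<forall>t\<in>{-r..r}. (\<lambda>n. \<Sum>i<Suc n. (t ^ i / fact i) *\<^sub>R a i) \<longlonglongrightarrow> f t
      \<and> (f has_derivative (\<lambda>h. h *\<^sub>R g t)) (at t within {-r..r})"
  proof (rule has_derivative_sequence[OF _ partial])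
    show "\<forall>\<^sub>F n in sequentially. \<forall>t\<in>{-r..r}. \<forall>h.
        norm (h *\<^sub>R (\<Sum>i<n. (t ^ i / fact i) *\<^sub>R a (Suc i)) - h *\<^sub>R g t) \<le> e * norm h"
      if "0 < e" for e
      using uniform_limitD[OF lim that]
    proof eventually_elim
      case (elim n)
      show ?case
      proof (intro ballI allI)
        fix t h :: real assume "t \<in> {-r..r}"
        then have "norm ((\<Sum>i<n. (t ^ i / fact i) *\<^sub>R a (Suc i)) - g t) \<le> e"
          using bspec[OF elim, of t] by (simp add: dist_norm)
        then show "norm (h *\<^sub>R (\<Sum>i<n. (t ^ i / fact i) *\<^sub>R a (Suc i)) - h *\<^sub>R g t) \<le> e * norm h"
          unfolding scaleR_diff_right[symmetric] norm_scaleR real_norm_def mult.commute[of e]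
          by (rule mult_left_mono) simp
      qed
    qed
    show "(\<lambda>n. \<Sum>i<Suc n. (t ^ i / fact i) *\<^sub>R a i)
        \<longlonglongrightarrow> (\<Sum>n. (t ^ n / fact n) *\<^sub>R a n)"
      using summable_LIMSEQ[OF summ] by (rule LIMSEQ_Suc)
  qed (auto simp: r_def)
  then obtain f where
      f: "(\<lambda>n. \<Sum>i<Suc n. (t ^ i / fact i) *\<^sub>R a i) \<longlonglongrightarrow> f t"
    and f': "(f has_derivative (\<lambda>h. h *\<^sub>R g t)) (at t within {-r..r})" if "t \<in> {-r..r}" for t
    by blast
  \<comment> \<open>The differentiation theorem yields only some limit function \<open>f\<close>;
    uniqueness of limits identifies it with the series.\<close>
  have f_eq: "f t = (\<Sum>n. (t ^ n / fact n) *\<^sub>R a n)" if "t \<in> {-r..r}" for t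
    by (rule LIMSEQ_unique[OF f[OF that] LIMSEQ_Suc[OF summable_LIMSEQ[OF summ]]])
  have t: "t \<in> {-r<..<r}" by (auto simp: r_def)
  then have "(f has_derivative (\<lambda>h. h *\<^sub>R g t)) (at t)"
    using f'[of t] at_within_Icc_at[of "-r" t r] by auto
  then have "((\<lambda>t. \<Sum>n. (t ^ n / fact n) *\<^sub>R a n) has_derivative (\<lambda>h. h *\<^sub>R g t)) (at t)"
    by (rule has_derivative_transform_within_open[OF _ _ t]) (auto simp: f_eq)
  then show "((\<lambda>t. \<Sum>n. (t ^ n / fact n) *\<^sub>R a n) has_vector_derivative
      (\<Sum>n. (t ^ n / fact n) *\<^sub>R a (Suc n))) (at t)"
    by (simp add: has_vector_derivative_def g_def)
qed

lemma norm_funpow_le: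
  fixes A :: "'a::real_normed_vector \<Rightarrow> 'a"
  assumes "bounded_linear A"
  shows "norm ((A ^^ n) x) \<le> norm x * onorm A ^ n"
proof (induction n)
  case (Suc n)
  have "norm (A ((A ^^ n) x)) \<le> onorm A * norm ((A ^^ n) x)"
    by (rule onorm[OF assms])
  also have "\<dots> \<le> onorm A * (norm x * onorm A ^ n)"
    by (intro mult_left_mono Suc onorm_pos_le assms)
  finally show ?case by (simp add: mult_ac)
qed simp

text \<open>Continuity of \<open>A\<close> lets it pass inside the series, where it turns
  \<open>A ^^ n\<close> into \<open>A ^^ Suc n\<close>; this is the shifted series of the
  derivative.\<close>

lemma
  fixes A :: "'a::banach \<Rightarrow> 'a"
  assumes A: "bounded_linear A"
  shows summable_op_exp: "summable (\<lambda>n. (t ^ n / fact n) *\<^sub>R (A ^^ n) x)"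
    and op_exp_has_vector_derivative:
      "((\<lambda>t. op_exp A t x) has_vector_derivative A (op_exp A t x)) (at t)"
proof -
  note series = exp_series_has_vector_derivative
    [OF norm_funpow_le[OF A, where x = x] onorm_pos_le[OF A], where t = t]
  show summ: "summable (\<lambda>n. (t ^ n / fact n) *\<^sub>R (A ^^ n) x)" by (rule series)
  have "A (op_exp A t x) = (\<Sum>n. (t ^ n / fact n) *\<^sub>R (A ^^ Suc n) x)"
    unfolding op_exp_def bounded_linear.suminf[OF A summ]
    by (simp add: linear_simps[OF A])
  then show "((\<lambda>t. op_exp A t x) has_vector_derivative A (op_exp A t x)) (at t)"
    using series(2) unfolding op_exp_def by simp
qed

lemma op_exp_0 [simp]: "op_exp A 0 x = x"
proof -
  have "(\<lambda>n. (0 ^ n / fact n) *\<^sub>R (A ^^ n) x) sums ((0 ^ 0 / fact 0) *\<^sub>R (A ^^ 0) x)"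
    using sums_finite[of "{0}" "\<lambda>n. (0 ^ n / fact n) *\<^sub>R (A ^^ n) x"] by simp
  then show ?thesis by (simp add: op_exp_def sums_iff)
qed

text \<open>With \<open>B\<close> a real or complex scaling, this gives homogeneity of the
  exponential over either field.\<close>

lemma op_exp_commute:
  fixes A :: "'a::banach \<Rightarrow> 'a"
  assumes A: "bounded_linear A" and B: "bounded_linear B" and AB: "\<And>x. A (B x) = B (A x)"
  shows "op_exp A t (B x) = B (op_exp A t x)"
proof -
  have "(A ^^ n) (B x) = B ((A ^^ n) x)" for n
    by (induction n) (auto simp: AB)
  then show ?thesis
    unfolding op_exp_def bounded_linear.suminf[OF B summable_op_exp[OF A]]
    by (simp add: linear_simps[OF B])
qed

lemma linear_op_exp:
  fixes A :: "'a::banach \<Rightarrow> 'a"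
  assumes A: "bounded_linear A"
  shows "linear (op_exp A t)"
proof (rule linearI)
  show "op_exp A t (r *\<^sub>R x) = r *\<^sub>R op_exp A t x" for r x
    by (rule op_exp_commute[OF A bounded_linear_scaleR_right]) (simp add: linear_simps[OF A])
  have "(A ^^ n) (x + y) = (A ^^ n) x + (A ^^ n) y" for n x y
    by (induction n) (auto simp: linear_simps[OF A])
  then show "op_exp A t (x + y) = op_exp A t x + op_exp A t y" for x y
    unfolding op_exp_def by (simp add: suminf_add summable_op_exp[OF A] scaleR_add_right)
qed

section \<open>Contractivity and the semigroup law for dissipative operators\<close>

lemma dissipative_norm_antimono:
  fixes u :: "real \<Rightarrow> 'a::real_inner"
  assumes A: "\<And>x. x \<bullet> A x \<le> 0"
    and u: "\<And>t. (u has_vector_derivative A (u t)) (at t)" and "s \<le> t"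
  shows "norm (u t) \<le> norm (u s)"
proof -
  \<comment> \<open>The squared norm has derivative \<open>2 * (u v \<bullet> A (u v))\<close>,
    which dissipativity makes nonpositive.\<close>
  have "u t \<bullet> u t \<le> u s \<bullet> u s"
  proof (rule DERIV_nonpos_imp_nonincreasing[OF \<open>s \<le> t\<close>])
    fix v
    have "((\<lambda>v. u v \<bullet> u v) has_derivative (\<lambda>h. u v \<bullet> (h *\<^sub>R A (u v)) + (h *\<^sub>R A (u v)) \<bullet> u v)) (at v)"
      using u[of v] unfolding has_vector_derivative_def by (intro has_derivative_inner)
    then have "((\<lambda>v. u v \<bullet> u v) has_real_derivative 2 * (u v \<bullet> A (u v))) (at v)"
      unfolding has_field_derivative_def
      by (rule has_derivative_eq_rhs) (auto simp: inner_commute)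
    then show "\<exists>y. ((\<lambda>v. u v \<bullet> u v) has_real_derivative y) (at v) \<and> y \<le> 0"
      using A[of "u v"] by (intro exI[of _ "2 * (u v \<bullet> A (u v))"]) auto
  qed
  then show ?thesis by (simp add: norm_eq_sqrt_inner)
qed

lemma op_exp_contraction:
  fixes A :: "'a::{real_inner,banach} \<Rightarrow> 'a"
  assumes A: "bounded_linear A" "\<And>x. x \<bullet> A x \<le> 0" and "0 \<le> t"
  shows "norm (op_exp A t x) \<le> norm x"
  using dissipative_norm_antimono[where u = "\<lambda>t. op_exp A t x", OF A(2)
      op_exp_has_vector_derivative[OF A(1)] \<open>0 \<le> t\<close>] by simp

text \<open>Both sides solve \<open>u' = A u\<close> in \<open>s\<close>, and the norm of their difference cannot increase from \<open>0\<close>.\<close>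

lemma op_exp_add:
  fixes A :: "'a::{real_inner,banach} \<Rightarrow> 'a"
  assumes A: "bounded_linear A" "\<And>x. x \<bullet> A x \<le> 0" and "0 \<le> s"
  shows "op_exp A (s + t) x = op_exp A s (op_exp A t x)"
proof -
  define u where "u s = op_exp A (s + t) x - op_exp A s (op_exp A t x)" for s
  have shift: "((\<lambda>s. op_exp A (s + t) x) has_vector_derivative A (op_exp A (s + t) x)) (at s)" for s
  proof -
    have "((\<lambda>s. s + t) has_vector_derivative 1) (at s)"
      unfolding has_real_derivative_iff_has_vector_derivative[symmetric]
      by (auto intro!: derivative_eq_intros)
    from vector_diff_chain_at[OF this op_exp_has_vector_derivative[OF A(1)]]
    show ?thesis by (simp add: o_def)
  qed
  have "(u has_vector_derivative A (u s)) (at s)" for s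
    unfolding u_def linear_simps[OF A(1)]
    by (intro has_vector_derivative_diff shift op_exp_has_vector_derivative[OF A(1)])
  then have "norm (u s) \<le> norm (u 0)"
    using dissipative_norm_antimono[where u = u, OF A(2) _ \<open>0 \<le> s\<close>] by blast
  then show ?thesis by (simp add: u_def)
qed

section \<open>The contraction semigroup of the negative Rhaly operator\<close>

theorem corollary2p8:
  fixes M :: "real measure" and R :: "ell2 \<Rightarrow> ell2"
  assumes "finite_measure M"
    and "sets M = sets (restrict_space borel {0..<1})"
    and "rhaly_operator (moment M) R"
    and "bounded_clinear R"
  shows "\<exists>T. contraction_semigroup T \<and> generates (\<lambda>x. - R x) T"
proof -
  define A where "A x = - R x" for x
  define T where "T = op_exp A"
  have R: "bounded_linear R" "\<And>c x. R (c *\<^sub>C x) = c *\<^sub>C R x"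
    using assms(4) by (auto simp: bounded_clinear_def)
  have A: "bounded_linear A"
    unfolding A_def by (intro bounded_linear_minus R)
  have neg: "x \<bullet> A x \<le> 0" for x
    using rhaly_operator_accretive[OF assms(3) decseq_moment[OF assms(1,2)] moment_nonneg[OF assms(1,2)]]
    by (simp add: A_def)
  have deriv: "((\<lambda>t. T t x) has_vector_derivative A (T t x)) (at t)" for x t
    unfolding T_def by (rule op_exp_has_vector_derivative[OF A])
  \<comment> \<open>The factor \<open>1\<close> matches the shape of bound used for
    \<open>bounded_linear\<close> and by \<open>onorm_bound\<close>.\<close>
  have norm_T: "norm (T s x) \<le> 1 * norm x" if "0 \<le> s" for s x
    using op_exp_contraction[OF A neg that] by (simp add: T_def)
  have clin: "T s (c *\<^sub>C x) = c *\<^sub>C T s x" for s c x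
    unfolding T_def
  proof (rule op_exp_commute[OF A bounded_linear_scale_ell2])
    show "A (c *\<^sub>C x) = c *\<^sub>C A x" for x
      by (simp add: A_def R linear_simps[OF bounded_linear_scale_ell2])
  qed
  have blin: "bounded_linear (T s)" if "0 \<le> s" for s
    using linear_op_exp[OF A, of s] norm_T[OF that]
    by (auto simp: T_def bounded_linear_def bounded_linear_axioms_def mult.commute intro: exI[of _ 1])
  have semigroup: "contraction_semigroup T"
    unfolding contraction_semigroup_def
  proof (intro conjI allI impI)
    show "bounded_clinear (T s)" if "0 \<le> s" for s
      using blin[OF that] clin by (simp add: bounded_clinear_def)
    show "T 0 = id" by (auto simp: T_def)
    show "T (s + t) = T s \<circ> T t" if "0 \<le> s" for s t
      using op_exp_add[OF A neg that] by (auto simp: T_def)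
    show "continuous_on {0..} (\<lambda>s. T s x)" for x
      using has_vector_derivative_continuous[OF deriv] by (intro continuous_at_imp_continuous_on) auto
    show "onorm (T s) \<le> 1" if "0 \<le> s" for s
      by (rule onorm_bound) (use norm_T[OF that] in auto)
  qed
  have "((\<lambda>h. (T h x - x) /\<^sub>R h) \<longlongrightarrow> A x) (at_right 0)" for x
  proof -
    have "((\<lambda>t. T t x) has_vector_derivative A x) (at_right 0)"
      using deriv[of x 0] by (auto simp: T_def intro: has_vector_derivative_at_within)
    then have "((\<lambda>h. (T h x - x - h *\<^sub>R A x) /\<^sub>R \<bar>h\<bar>) \<longlongrightarrow> 0) (at_right 0)"
      by (simp add: has_vector_derivative_def has_derivative_at_within T_def)
    \<comment> \<open>To the right of \<open>0\<close> one has \<open>\<bar>h\<bar> = h\<close>, so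
      the remainder quotient of the derivative equals the difference quotient minus
      \<open>A x\<close>.\<close>
    then have "((\<lambda>h. (T h x - x) /\<^sub>R h - A x) \<longlongrightarrow> 0) (at_right 0)"
      by (rule Lim_transform_eventually)
        (auto simp: eventually_at_filter scaleR_diff_right)
    then show ?thesis by (rule LIM_zero_cancel)
  qed
  \<comment> \<open>The limit exists at every \<open>x\<close>, so the generator has full domain;
    uniqueness of limits excludes any other value.\<close>
  then have "generator_graph T = {(x, y). y = A x}"
    unfolding generator_graph_def
    by (auto dest: tendsto_unique[OF trivial_limit_at_right_real])
  then have "generates (\<lambda>x. - R x) T" by (simp add: generates_def A_def)
  with semigroup show ?thesis by blast
qed

end
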